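(* Let $A_{m,\times}=Q_m^{\top}AQ_{m,\perp}=\beta_m e_me_1^{\top}$, $\gamma=\beta_m^2(T_m^{-1})_{mm}$, $S_\perp=T_{m,\perp}-\gamma e_1e_1^{\top}$, and $$q_\parallel=\beta_m Q_mT_m^{-1}e_m,\qquad q_\perp=Q_{m,\perp}S_\perp^{-1}e_1 .$$ Then the blocks of $A^{-1}$ in the basis $[\,Q_m\ \ Q_{m,\perp}\,]$ are: (i) $Q_{m,\perp}^{\top}A^{-1}Q_{m,\perp}=S_\perp^{-1}$; (ii) $Q_m^{\top}A^{-1}Q_m=T_m^{-1}+\beta_m^2\,(S_\perp^{-1})_{11}\,(T_m^{-1}e_m)(T_m^{-1}e_m)^{\top}$; (iii) $Q_m^{\top}A^{-1}Q_{m,\perp}=-T_m^{-1}A_{m,\times}S_\perp^{-1}=-\beta_m\,(T_m^{-1}e_m)(S_\perp^{-1}e_1)^{\top}$. In the full space, $$A^{-1}=Q_mT_m^{-1}Q_m^{\top}+(S_\perp^{-1})_{11}\,q_\parallel q_\parallel^{\top}-q_\parallel q_\perp^{\top}-q_\perp q_\parallel^{\top}+Q_{m,\perp}S_\perp^{-1}Q_{m,\perp}^{\top}.$$ If $\beta_m=0$, the terms involving $q_\parallel$, $q_\perp$ and $\gamma$ drop out and this identity reduces to $A^{-1}=Q_mT_m^{-1}Q_m^{\top}+Q_{m,\perp}T_{m,\perp}^{-1}Q_{m,\perp}^{\top}$.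
   Context: $A\in\mathbb{R}^{d\times d}$ is symmetric positive definite and $1\le m<d$. Starting from a unit vector $q_1=v_{\mathrm{ref}}/\|v_{\mathrm{ref}}\|_2$, $m$ steps of the Lanczos algorithm (exact arithmetic, no breakdown before step $m$) produce $Q_m=[q_1,\dots,q_m]\in\mathbb{R}^{d\times m}$ with orthonormal columns, a symmetric tridiagonal positive definite matrix $T_m=Q_m^{\top}AQ_m$, a scalar $\beta_m\ge0$, and a unit vector $q_{m+1}\perp\mathrm{range}(Q_m)$ (any such unit vector if $\beta_m=0$) with $AQ_m=Q_mT_m+\beta_mq_{m+1}e_m^{\top}$. $Q_{m,\perp}\in\mathbb{R}^{d\times(d-m)}$ has orthonormal columns spanning the orthogonal complement of $\mathrm{range}(Q_m)$, with first column $q_{m+1}$; $T_{m,\perp}=Q_{m,\perp}^{\top}AQ_{m,\perp}$ (symmetric positive definite). $e_m\in\mathbb{R}^m$ is the last and $e_1\in\mathbb{R}^{d-m}$ the first coordinate vector. $S_\perp=T_{m,\perp}-A_{m,\times}^{\top}T_m^{-1}A_{m,\times}$ is the Schur complement of $T_m$ in the block form of $A$, hence symmetric positive definite. *)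

theory Defs
  imports Complex_Main
    "Jordan_Normal_Form.Matrix"
    "Jordan_Normal_Form.Gauss_Jordan_Elimination"
    "Jordan_Normal_Form.VS_Connect"
begin

definition vec_norm2 :: "real vec \<Rightarrow> real" where
  "vec_norm2 v = sqrt (v \<bullet> v)"

definition outer_prod :: "real vec \<Rightarrow> real vec \<Rightarrow> real mat" where
  "outer_prod u v = mat (dim_vec u) (dim_vec v) (\<lambda>(i, j). u $ i * v $ j)"

definition sym_pos_def :: "nat \<Rightarrow> real mat \<Rightarrow> bool" where
  "sym_pos_def n M \<longleftrightarrow> M \<in> carrier_mat n n \<and> M\<^sup>T = M \<and>
     (\<forall>x \<in> carrier_vec n. x \<noteq> 0\<^sub>v n \<longrightarrow> x \<bullet> (M *\<^sub>v x) > 0)"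

text \<open>Only meaningful for invertible \<open>M\<close>: \<^const>\<open>mat_inverse\<close> is \<^const>\<open>None\<close> on singular matrices.\<close>
definition minv :: "real mat \<Rightarrow> real mat" where
  "minv M = the (mat_inverse M)"

definition orthonormal_cols :: "real mat \<Rightarrow> bool" where
  "orthonormal_cols M \<longleftrightarrow> M\<^sup>T * M = 1\<^sub>m (dim_col M)"

text \<open>
  A run of \<open>m\<close> steps of the Lanczos algorithm on \<open>A\<close> from the reference vector \<open>v\<close>, without
  breakdown before step \<open>m\<close>. The sequences are indexed from 1, as usual for the three-term recurrence
  \<open>\<beta>\<^sub>j q\<^sub>j\<^sub>+\<^sub>1 = A q\<^sub>j - \<alpha>\<^sub>j q\<^sub>j - \<beta>\<^sub>j\<^sub>-\<^sub>1 q\<^sub>j\<^sub>-\<^sub>1\<close>; the entries at 0 only encode \<open>\<beta>\<^sub>0 q\<^sub>0 = 0\<close>.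
  If the last residual vanishes, \<open>q\<^sub>m\<^sub>+\<^sub>1\<close> is an arbitrary unit vector orthogonal to \<open>q\<^sub>1, \<dots>, q\<^sub>m\<close>.
  Orthonormality of the \<open>q\<^sub>j\<close> is not part of the definition.
\<close>
definition lanczos_run ::
  "real mat \<Rightarrow> real vec \<Rightarrow> nat \<Rightarrow> (nat \<Rightarrow> real) \<Rightarrow> (nat \<Rightarrow> real) \<Rightarrow> (nat \<Rightarrow> real vec) \<Rightarrow> bool" where
  "lanczos_run A v m \<alpha> \<beta> q \<longleftrightarrow>
     \<beta> 0 = 0 \<and> q 0 = 0\<^sub>v (dim_vec v) \<and>
     q 1 = (1 / vec_norm2 v) \<cdot>\<^sub>v v \<and>
     (\<forall>j \<in> {1..m}.
        let r = A *\<^sub>v q j - \<alpha> j \<cdot>\<^sub>v q j - \<beta> (j - 1) \<cdot>\<^sub>v q (j - 1)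
        in \<alpha> j = q j \<bullet> (A *\<^sub>v q j) \<and>
           \<beta> j = vec_norm2 r \<and>
           (\<beta> j \<noteq> 0 \<longrightarrow> q (j + 1) = (1 / \<beta> j) \<cdot>\<^sub>v r)) \<and>
     (\<forall>j \<in> {1..<m}. \<beta> j \<noteq> 0) \<and>
     (\<beta> m = 0 \<longrightarrow>
        q (m + 1) \<in> carrier_vec (dim_vec v) \<and> vec_norm2 (q (m + 1)) = 1 \<and>
        (\<forall>j \<in> {1..m}. q j \<bullet> q (m + 1) = 0))"

end

theory Submission
  imports Defs "Jordan_Normal_Form.Determinant"
begin

text \<open>The Lanczos recurrence makes \<open>[Q Qp]\<close> orthogonal and makes the off-diagonal block of \<open>A\<close> in this
  basis the rank-one matrix \<open>\<beta>\<^sub>m e\<^sub>m e\<^sub>1\<^sup>T\<close>. Block elimination in \<open>A A\<^sup>-\<^sup>1 = 1\<close> then yields the blocks of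
  \<open>A\<^sup>-\<^sup>1\<close> in terms of the Schur complement, and rank-one algebra simplifies them.\<close>

lemma mult_mat_assoc:
  fixes A B C :: "real mat"
  assumes "dim_col A = dim_row B" "dim_col B = dim_row C"
  shows "A * B * C = A * (B * C)"
  using assms by (intro assoc_mult_mat) auto

lemma mult_mat_add_left:
  fixes A B C :: "real mat"
  assumes "dim_row A = dim_row B" "dim_col A = dim_col B" "dim_col B = dim_row C"
  shows "(A + B) * C = A * C + B * C"
  using assms by (intro add_mult_distrib_mat) auto

lemma mult_mat_add_right:
  fixes A B C :: "real mat"
  assumes "dim_row B = dim_row C" "dim_col B = dim_col C" "dim_col A = dim_row C"
  shows "A * (B + C) = A * B + A * C"
  using assms by (intro mult_add_distrib_mat) auto

lemma mult_mat_uminus_right: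
  fixes A B :: "real mat"
  assumes "dim_col A = dim_row B"
  shows "A * (- B) = - (A * B)"
  using assms by (intro uminus_mult_right_mat) auto

lemma mult_mat_smult_left:
  fixes A B :: "real mat"
  assumes "dim_col A = dim_row B"
  shows "(c \<cdot>\<^sub>m A) * B = c \<cdot>\<^sub>m (A * B)"
  using assms by (intro mult_smult_assoc_mat) auto

lemma mult_mat_smult_right:
  fixes A B :: "real mat"
  assumes "dim_col A = dim_row B"
  shows "A * (c \<cdot>\<^sub>m B) = c \<cdot>\<^sub>m (A * B)"
  using assms by (intro mult_smult_distrib) auto

lemma smult_smult_mat: "a \<cdot>\<^sub>m (b \<cdot>\<^sub>m M) = (a * b :: real) \<cdot>\<^sub>m M"
  by (intro eq_matI) auto

lemma transpose_mat_mult: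
  fixes A B :: "real mat"
  assumes "dim_col A = dim_row B"
  shows "(A * B)\<^sup>T = B\<^sup>T * A\<^sup>T"
  using assms by (intro transpose_mult) auto

lemma mult_mat_one_left: "dim_row A = n \<Longrightarrow> 1\<^sub>m n * (A :: real mat) = A"
  by (rule left_mult_one_mat') auto

lemma mult_mat_one_right: "dim_col A = n \<Longrightarrow> (A :: real mat) * 1\<^sub>m n = A"
  by (rule right_mult_one_mat') auto

section \<open>Rank-one algebra of outer products\<close>

lemma dim_outer_prod [simp]:
  "dim_row (outer_prod u v) = dim_vec u" "dim_col (outer_prod u v) = dim_vec v"
  by (auto simp: outer_prod_def)

lemma index_outer_prod [simp]:
  "i < dim_vec u \<Longrightarrow> j < dim_vec v \<Longrightarrow> outer_prod u v $$ (i, j) = u $ i * v $ j"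
  by (auto simp: outer_prod_def)

lemma transpose_outer_prod: "(outer_prod u v)\<^sup>T = outer_prod v u"
  by (intro eq_matI) auto

lemma outer_prod_smult:
  "outer_prod (c \<cdot>\<^sub>v u) v = c \<cdot>\<^sub>m outer_prod u v"
  "outer_prod u (c \<cdot>\<^sub>v v) = c \<cdot>\<^sub>m outer_prod u v"
  by (intro eq_matI; auto)+

lemma mult_outer_prod:
  assumes "dim_col M = dim_vec u"
  shows "M * outer_prod u v = outer_prod (M *\<^sub>v u) v"
  using assms
  by (intro eq_matI)
     (auto simp: scalar_prod_def sum_distrib_right intro!: sum.cong)

lemma outer_prod_mult:
  assumes "dim_row M = dim_vec v"
  shows "outer_prod u v * M = outer_prod u (M\<^sup>T *\<^sub>v v)"
  using assms
  by (intro eq_matI)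
     (auto simp: scalar_prod_def sum_distrib_left intro!: sum.cong)

lemma outer_prod_mult_outer_prod:
  assumes "dim_vec b = dim_vec c"
  shows "outer_prod a b * outer_prod c e = (b \<bullet> c) \<cdot>\<^sub>m outer_prod a e"
  using assms
  by (intro eq_matI)
     (auto simp: scalar_prod_def sum_distrib_left sum_distrib_right intro!: sum.cong)

lemma unit_vec_quadratic_form:
  assumes "M \<in> carrier_mat n n" "i < n"
  shows "unit_vec n i \<bullet> (M *\<^sub>v unit_vec n i) = (M :: real mat) $$ (i, i)"
  using assms by (simp add: scalar_prod_left_unit[of _ n])

section \<open>Inverses of symmetric positive definite matrices\<close>

text \<open>A right inverse of a square matrix is also a left inverse, so \<open>M\<close> is a
  unit, \<open>mat_inverse M\<close> is not \<open>None\<close>, and uniqueness of inverses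
  identifies its value with \<open>B\<close>. This is the way around the undefined case of
  \<open>minv\<close>.\<close>

lemma minv_eqI:
  assumes M: "M \<in> carrier_mat n n" and B: "B \<in> carrier_mat n n" and MB: "M * B = 1\<^sub>m n"
  shows "minv M = B" "invertible_mat M"
proof -
  have BM: "B * M = 1\<^sub>m n" using mat_mult_left_right_inverse[OF M B MB] .
  show "invertible_mat M"
    unfolding invertible_mat_def inverts_mat_def using M B MB BM by auto
  have "M \<in> Units (ring_mat TYPE(real) n ())"
    unfolding Units_def ring_mat_def using M B MB BM by auto
  then obtain C where C: "mat_inverse M = Some C"
    using mat_inverse(1)[OF M, of "()"] by (cases "mat_inverse M") auto
  from mat_inverse(2)[OF M C] have "C * M = 1\<^sub>m n" "C \<in> carrier_mat n n" by auto
  then have "C = B"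
    using assoc_mult_mat[of C n n M n B n] M B MB by simp
  then show "minv M = B" unfolding minv_def using C by simp
qed

text \<open>A nonzero kernel vector \<open>x\<close> would give
  \<open>x \<bullet> (M *\<^sub>v x) = 0\<close>, so the determinant is nonzero. Transposing
  \<open>M * B = 1\<close> shows that the transpose of the inverse \<open>B\<close> is an inverse
  too, hence equals \<open>B\<close>.\<close>

lemma sym_pos_def_minv:
  assumes "sym_pos_def n M"
  shows "minv M \<in> carrier_mat n n" "M * minv M = 1\<^sub>m n" "minv M * M = 1\<^sub>m n"
    "(minv M)\<^sup>T = minv M" "invertible_mat M"
proof -
  have M: "M \<in> carrier_mat n n" and sym: "M\<^sup>T = M"
    and pos: "\<And>x. x \<in> carrier_vec n \<Longrightarrow> x \<noteq> 0\<^sub>v n \<Longrightarrow> x \<bullet> (M *\<^sub>v x) > 0"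
    using assms unfolding sym_pos_def_def by auto
  have "det M \<noteq> 0"
    unfolding det_0_iff_vec_prod_zero_field[OF M] using pos by fastforce
  then obtain B where B: "B \<in> carrier_mat n n" and MB: "M * B = 1\<^sub>m n" and BM: "B * M = 1\<^sub>m n"
    using det_non_zero_imp_unit[OF M, of "()"] unfolding Units_def ring_mat_def by auto
  note inv = minv_eqI[OF M B MB]
  have "B\<^sup>T * M = 1\<^sub>m n"
    using MB M B sym by (metis transpose_mult transpose_one)
  then have "M * B\<^sup>T = 1\<^sub>m n"
    using mat_mult_left_right_inverse[of "B\<^sup>T" n M] M B by auto
  then have "B\<^sup>T = B" using minv_eqI(1)[OF M, of "B\<^sup>T"] inv B by auto
  with inv B MB BM show "minv M \<in> carrier_mat n n" "M * minv M = 1\<^sub>m n" "minv M * M = 1\<^sub>m n"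
    "(minv M)\<^sup>T = minv M" "invertible_mat M" by auto
qed

text \<open>The quadratic form at \<open>x\<close> is that of \<open>A\<close> at
  \<open>Q *\<^sub>v x\<close>, and \<open>Q\<close> is injective because its transpose is a left
  inverse. Applied to the Lanczos basis, it makes \<open>T\<close> invertible.\<close>

lemma sym_pos_def_compress:
  assumes A: "sym_pos_def n A" and Q: "Q \<in> carrier_mat n k" "Q\<^sup>T * Q = 1\<^sub>m k"
  shows "sym_pos_def k (Q\<^sup>T * A * Q)"
proof -
  have Ac: "A \<in> carrier_mat n n" and sym: "A\<^sup>T = A"
    using A unfolding sym_pos_def_def by auto
  have "x \<bullet> (Q\<^sup>T * A * Q *\<^sub>v x) > 0" if x: "x \<in> carrier_vec k" "x \<noteq> 0\<^sub>v k" for x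
  proof -
    have Qx: "Q *\<^sub>v x \<in> carrier_vec n" using Q x by auto
    have "Q\<^sup>T *\<^sub>v (Q *\<^sub>v x) = (Q\<^sup>T * Q) *\<^sub>v x"
      using Q x by (intro assoc_mult_mat_vec[symmetric]) auto
    also have "\<dots> = x" using Q x by simp
    finally have left_inv: "Q\<^sup>T *\<^sub>v (Q *\<^sub>v x) = x" .
    have "Q *\<^sub>v x \<noteq> 0\<^sub>v n"
    proof
      assume "Q *\<^sub>v x = 0\<^sub>v n"
      then have "x = Q\<^sup>T *\<^sub>v 0\<^sub>v n" using left_inv by simp
      also have "\<dots> = 0\<^sub>v k" using Q by (intro eq_vecI) auto
      finally show False using x by simp
    qed
    then have "0 < (Q *\<^sub>v x) \<bullet> (A *\<^sub>v (Q *\<^sub>v x))"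
      using A Qx unfolding sym_pos_def_def by auto
    also have "\<dots> = x \<bullet> (Q\<^sup>T *\<^sub>v (A *\<^sub>v (Q *\<^sub>v x)))"
      using transpose_vec_mult_scalar[of "Q\<^sup>T" k n "A *\<^sub>v (Q *\<^sub>v x)" x] Q x Ac by simp
    also have "Q\<^sup>T *\<^sub>v (A *\<^sub>v (Q *\<^sub>v x)) = Q\<^sup>T * A * Q *\<^sub>v x"
      using Q x Ac Qx
      by (simp add: assoc_mult_mat_vec[of _ k n _ k] assoc_mult_mat_vec[of _ k n _ n])
    finally show ?thesis .
  qed
  moreover have "(Q\<^sup>T * A * Q)\<^sup>T = Q\<^sup>T * A * Q"
    using Q Ac sym by (simp add: transpose_mat_mult mult_mat_assoc)
  ultimately show ?thesis unfolding sym_pos_def_def using Q Ac by auto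
qed

section \<open>Block inversion in an orthonormal basis\<close>

text \<open>The matrix \<open>[Q P]\<close> is square and its transpose is a left inverse, hence
  also a right inverse; the latter is the resolution of the identity.\<close>

lemma orthonormal_cols_completion:
  assumes Q: "Q \<in> carrier_mat (m + k) m" "Q\<^sup>T * Q = 1\<^sub>m m"
    and P: "P \<in> carrier_mat (m + k) k" "P\<^sup>T * P = 1\<^sub>m k"
    and QP: "Q\<^sup>T * P = 0\<^sub>m m k"
  shows "Q * Q\<^sup>T + P * P\<^sup>T = (1\<^sub>m (m + k) :: real mat)"
proof -
  \<comment> \<open>Lower blocks of height zero turn the horizontal concatenation into a
    \<open>four_block_mat\<close>, so the block multiplication and transposition rules
    apply.\<close>
  let ?U = "four_block_mat Q P (0\<^sub>m 0 m) (0\<^sub>m 0 k)"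
  have UT: "?U\<^sup>T = four_block_mat Q\<^sup>T (0\<^sub>m m 0) P\<^sup>T (0\<^sub>m k 0)"
    using Q P by (subst transpose_four_block_mat) auto
  have PQ: "P\<^sup>T * Q = 0\<^sub>m k m"
    using arg_cong[OF QP, of transpose_mat] Q P by (simp add: transpose_mat_mult)
  have "?U\<^sup>T * ?U = four_block_mat (1\<^sub>m m) (0\<^sub>m m k) (0\<^sub>m k m) (1\<^sub>m k)"
    unfolding UT using Q P QP PQ
    by (subst mult_four_block_mat[of _ m "m + k" _ 0 _ k _ _ m _ k]) auto
  also have "\<dots> = 1\<^sub>m (m + k)" by (rule four_block_one_mat)
  finally have "?U * ?U\<^sup>T = 1\<^sub>m (m + k)"
    using Q P by (intro mat_mult_left_right_inverse[of "?U\<^sup>T"]) auto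
  moreover have "?U * ?U\<^sup>T = four_block_mat (Q * Q\<^sup>T + P * P\<^sup>T) (0\<^sub>m (m + k) 0) (0\<^sub>m 0 (m + k)) (0\<^sub>m 0 0)"
    unfolding UT using Q P
    by (subst mult_four_block_mat[of _ "m + k" m _ k _ 0 _ _ "m + k" _ 0]) auto
  moreover have "\<dots> = Q * Q\<^sup>T + P * P\<^sup>T"
    using Q P by (intro eq_matI) auto
  ultimately show ?thesis by simp
qed

lemma mat_eq_uminus_if_add_zero:
  assumes "A \<in> carrier_mat n k" "B \<in> carrier_mat n k" "A + B = 0\<^sub>m n k"
  shows "(A :: real mat) = - B"
proof (intro eq_matI)
  fix i j assume "i < dim_row (- B)" "j < dim_col (- B)"
  then have "(A + B) $$ (i, j) = 0" "i < n" "j < k" using assms by auto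
  then show "A $$ (i, j) = (- B) $$ (i, j)" using assms(1,2) by auto
qed (use assms in auto)

lemma mat_eq_minus_if_add:
  assumes "A \<in> carrier_mat n k" "B \<in> carrier_mat n k" "A + B = C"
  shows "(A :: real mat) = C - B"
  using assms by (intro eq_matI) auto

text \<open>The blocks \<open>X, Y, Z\<close> of \<open>A\<^sup>-\<^sup>1\<close> are read off from \<open>A A\<^sup>-\<^sup>1 = 1\<close>, written in the basis
  \<open>[Q P]\<close>; in particular \<open>S Z = 1\<close>, which gives the invertibility of \<open>S\<close>.\<close>

lemma block_inverse:
  fixes A Q P :: "real mat"
  assumes A: "sym_pos_def n A"
    and Q: "Q \<in> carrier_mat n m" and P: "P \<in> carrier_mat n k"
    and orth: "Q\<^sup>T * Q = 1\<^sub>m m" "P\<^sup>T * P = 1\<^sub>m k" "Q\<^sup>T * P = 0\<^sub>m m k"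
    and full: "Q * Q\<^sup>T + P * P\<^sup>T = 1\<^sub>m n"
    and T_def: "T = Q\<^sup>T * A * Q" and R_def: "R = P\<^sup>T * A * P" and B_def: "B = Q\<^sup>T * A * P"
    and S_def: "S = R - B\<^sup>T * minv T * B"
  shows "invertible_mat S" "minv S \<in> carrier_mat k k" "(minv S)\<^sup>T = minv S"
    "P\<^sup>T * minv A * P = minv S"
    "Q\<^sup>T * minv A * P = - (minv T * B * minv S)"
    "Q\<^sup>T * minv A * Q = minv T + minv T * B * minv S * B\<^sup>T * minv T"
    "minv A = Q * (Q\<^sup>T * minv A * Q) * Q\<^sup>T + Q * (Q\<^sup>T * minv A * P) * P\<^sup>T
       + P * (Q\<^sup>T * minv A * P)\<^sup>T * Q\<^sup>T + P * (P\<^sup>T * minv A * P) * P\<^sup>T"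
proof -
  define V X Y Z where "V = minv A" and "X = Q\<^sup>T * V * Q" and "Y = Q\<^sup>T * V * P" and "Z = P\<^sup>T * V * P"
  define W where "W = minv T"
  have Ac: "A \<in> carrier_mat n n" and At: "A\<^sup>T = A" using A unfolding sym_pos_def_def by auto
  note V = sym_pos_def_minv[OF A, folded V_def]
  note W = sym_pos_def_minv[OF sym_pos_def_compress[OF A Q orth(1), folded T_def], folded W_def]
  note dims = carrier_matD[OF Q] carrier_matD[OF P] carrier_matD[OF Ac] carrier_matD[OF V(1)]
    carrier_matD[OF W(1)]
  have T: "T \<in> carrier_mat m m" and R: "R \<in> carrier_mat k k" and B: "B \<in> carrier_mat m k"
    and X: "X \<in> carrier_mat m m" and Y: "Y \<in> carrier_mat m k" and Z: "Z \<in> carrier_mat k k"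
    unfolding T_def R_def B_def X_def Y_def Z_def using dims by (auto intro!: carrier_matI)
  note dims = dims carrier_matD[OF T] carrier_matD[OF R] carrier_matD[OF B]
    carrier_matD[OF X] carrier_matD[OF Y] carrier_matD[OF Z]
  have YT: "Y\<^sup>T = P\<^sup>T * V * Q" and ZT: "Z\<^sup>T = Z" and BT: "B\<^sup>T = P\<^sup>T * A * Q"
    unfolding Y_def Z_def B_def using dims V At by (simp_all add: transpose_mat_mult mult_mat_assoc)
  \<comment> \<open>Inserting the resolution of the identity between \<open>A\<close> and its
    inverse \<open>V\<close>. The choices \<open>(Q, Q)\<close>, \<open>(Q, P)\<close> and
    \<open>(P, P)\<close> for \<open>(F, G)\<close> give the block equations.\<close>
  have split: "F\<^sup>T * A * Q * (Q\<^sup>T * V * G) + F\<^sup>T * A * P * (P\<^sup>T * V * G) = F\<^sup>T * G"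
    if F: "F \<in> carrier_mat n a" and G: "G \<in> carrier_mat n b" for F G a b
  proof -
    note d = dims carrier_matD[OF F] carrier_matD[OF G]
    have "F\<^sup>T * A * Q * (Q\<^sup>T * V * G) + F\<^sup>T * A * P * (P\<^sup>T * V * G)
        = F\<^sup>T * A * (Q * Q\<^sup>T + P * P\<^sup>T) * V * G"
      using d by (simp add: mult_mat_assoc mult_mat_add_left mult_mat_add_right)
    also have "\<dots> = F\<^sup>T * (A * V) * G"
      unfolding full using d by (simp add: mult_mat_assoc mult_mat_one_left)
    also have "\<dots> = F\<^sup>T * G" using d V by (simp add: mult_mat_one_right)
    finally show ?thesis .
  qed
  have TX: "T * X + B * Y\<^sup>T = 1\<^sub>m m" and TY: "T * Y + B * Z = 0\<^sub>m m k"
    and BY: "B\<^sup>T * Y + R * Z = 1\<^sub>m k"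
    using split[OF Q Q] split[OF Q P] split[OF P P] orth
    by (simp_all add: T_def R_def B_def X_def YT[unfolded B_def] BT[unfolded B_def] Y_def Z_def
      YT[unfolded Y_def])
  \<comment> \<open>Block elimination: the equation for the \<open>(Q, P)\<close> block is solved
    for \<open>Y\<close> in terms of \<open>Z\<close>.\<close>
  have "Y = W * (T * Y)" using W dims by (simp add: mult_mat_one_left flip: mult_mat_assoc)
  also have "T * Y = - (B * Z)"
    using TY dims by (intro mat_eq_uminus_if_add_zero) (auto intro!: carrier_matI)
  finally have Y_eq: "Y = - (W * B * Z)" using dims by (simp add: mult_mat_uminus_right mult_mat_assoc)
  have YT_eq: "Y\<^sup>T = - (Z * B\<^sup>T * W)"
    unfolding Y_eq using dims W ZT by (simp add: transpose_uminus transpose_mat_mult mult_mat_assoc)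
  have S: "S \<in> carrier_mat k k"
    unfolding S_def W_def[symmetric] using dims by (auto intro!: carrier_matI)
  \<comment> \<open>Substituting the formula for \<open>Y\<close> into the \<open>(P, P)\<close>
    equation leaves exactly the Schur complement acting on \<open>Z\<close>.\<close>
  have "S * Z = R * Z - B\<^sup>T * W * B * Z"
    unfolding S_def W_def[symmetric] using dims
    by (intro minus_mult_distrib_mat[of _ k k]) (auto intro!: carrier_matI)
  also have "\<dots> = B\<^sup>T * Y + R * Z"
    unfolding Y_eq using dims by (intro eq_matI) (auto simp: mult_mat_uminus_right mult_mat_assoc)
  finally have SZ: "S * Z = 1\<^sub>m k" using BY by simp
  note S_inv = minv_eqI[OF S Z SZ]
  show "invertible_mat S" "minv S \<in> carrier_mat k k" "(minv S)\<^sup>T = minv S"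
    "P\<^sup>T * minv A * P = minv S" "Q\<^sup>T * minv A * P = - (minv T * B * minv S)"
    using S_inv Z ZT Y_eq by (simp_all add: Z_def Y_def V_def W_def)
  \<comment> \<open>The \<open>(Q, Q)\<close> equation now determines \<open>X\<close>, since the
    transpose of \<open>Y\<close> is known.\<close>
  have "X = W * (T * X)" using W dims by (simp add: mult_mat_one_left flip: mult_mat_assoc)
  also have "T * X = 1\<^sub>m m - B * Y\<^sup>T"
    using TX dims by (intro mat_eq_minus_if_add) (auto intro!: carrier_matI)
  also have "\<dots> = 1\<^sub>m m + B * Z * B\<^sup>T * W"
    unfolding YT_eq using dims by (intro eq_matI) (auto simp: mult_mat_uminus_right mult_mat_assoc)
  finally have "X = W + W * B * Z * B\<^sup>T * W"
    using dims by (simp add: mult_mat_add_right mult_mat_one_right mult_mat_assoc)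
  then show "Q\<^sup>T * minv A * Q = minv T + minv T * B * minv S * B\<^sup>T * minv T"
    by (simp add: X_def V_def W_def S_inv)
  \<comment> \<open>Resolving the identity on both sides of \<open>V\<close> reassembles it from its
    four blocks.\<close>
  have "V = (Q * Q\<^sup>T + P * P\<^sup>T) * V * (Q * Q\<^sup>T + P * P\<^sup>T)"
    unfolding full using dims by (simp add: mult_mat_one_left mult_mat_one_right)
  also have "\<dots> = Q * X * Q\<^sup>T + Q * Y * P\<^sup>T + P * Y\<^sup>T * Q\<^sup>T + P * Z * P\<^sup>T"
    unfolding X_def YT Z_def unfolding Y_def using dims
    by (intro eq_matI) (auto simp: mult_mat_assoc mult_mat_add_left mult_mat_add_right)
  finally show "minv A = Q * (Q\<^sup>T * minv A * Q) * Q\<^sup>T + Q * (Q\<^sup>T * minv A * P) * P\<^sup>T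
       + P * (Q\<^sup>T * minv A * P)\<^sup>T * Q\<^sup>T + P * (P\<^sup>T * minv A * P) * P\<^sup>T"
    unfolding X_def Y_def Z_def V_def .
qed

section \<open>The Lanczos recurrence and orthonormality of its vectors\<close>

lemma scalar_prod_self_nonneg: "(v :: real vec) \<bullet> v \<ge> 0"
  unfolding scalar_prod_def by (intro sum_nonneg) auto

lemma vec_norm2_sq: "(vec_norm2 v)\<^sup>2 = v \<bullet> v"
  unfolding vec_norm2_def using scalar_prod_self_nonneg by simp

lemma vec_norm2_eq_0:
  assumes "v \<in> carrier_vec n" "vec_norm2 v = 0"
  shows "v = 0\<^sub>v n"
proof (rule eq_vecI)
  have "(\<Sum>i\<in>{0..<n}. v $ i * v $ i) = 0"
    using vec_norm2_sq[of v] assms unfolding scalar_prod_def by auto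
  then show "v $ i = 0\<^sub>v n $ i" if "i < dim_vec (0\<^sub>v n)" for i
    using that by (subst (asm) sum_nonneg_eq_0_iff) auto
qed (use assms in auto)

lemma scalar_prod_normalized:
  assumes "vec_norm2 v \<noteq> 0"
  shows "((1 / vec_norm2 v) \<cdot>\<^sub>v v) \<bullet> ((1 / vec_norm2 v) \<cdot>\<^sub>v v) = 1"
proof -
  have "v \<bullet> v = vec_norm2 v * vec_norm2 v"
    using vec_norm2_sq[of v] by (simp add: power2_eq_square)
  then show ?thesis using assms by simp
qed

text \<open>Division-free form of the recurrence. If \<open>\<beta> j = 0\<close>, the residual has
  norm zero and so vanishes, and the identity holds whatever vector \<open>q (j + 1)\<close> is;
  otherwise it is the normalization multiplied out.\<close>

lemma lanczos_step:
  assumes A: "A \<in> carrier_mat d d" and v: "v \<in> carrier_vec d"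
    and run: "lanczos_run A v m \<alpha> \<beta> q"
  shows "j \<le> m \<Longrightarrow> q j \<in> carrier_vec d \<and> q (j + 1) \<in> carrier_vec d"
    "j \<in> {1..m} \<Longrightarrow> A *\<^sub>v q j = \<alpha> j \<cdot>\<^sub>v q j + \<beta> (j - 1) \<cdot>\<^sub>v q (j - 1) + \<beta> j \<cdot>\<^sub>v q (j + 1)"
    "j \<in> {1..m} \<Longrightarrow> \<alpha> j = q j \<bullet> (A *\<^sub>v q j)"
    "j \<in> {1..m} \<Longrightarrow> \<beta> j \<noteq> 0 \<Longrightarrow> q (j + 1) \<bullet> q (j + 1) = 1"
    "j \<in> {1..<m} \<Longrightarrow> \<beta> j \<noteq> 0"
proof -
  define r where "r j = A *\<^sub>v q j - \<alpha> j \<cdot>\<^sub>v q j - \<beta> (j - 1) \<cdot>\<^sub>v q (j - 1)" for j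
  have q0: "q 0 = 0\<^sub>v d" and q1: "q 1 = (1 / vec_norm2 v) \<cdot>\<^sub>v v"
    and nz: "\<And>j. j \<in> {1..<m} \<Longrightarrow> \<beta> j \<noteq> 0"
    and last: "\<beta> m = 0 \<Longrightarrow> q (m + 1) \<in> carrier_vec d"
    using run v unfolding lanczos_run_def by auto
  have step: "\<alpha> j = q j \<bullet> (A *\<^sub>v q j)" "\<beta> j = vec_norm2 (r j)"
      "\<beta> j \<noteq> 0 \<Longrightarrow> q (j + 1) = (1 / \<beta> j) \<cdot>\<^sub>v r j" if "j \<in> {1..m}" for j
    using run that unfolding lanczos_run_def r_def Let_def by auto
  have carr: "q j \<in> carrier_vec d \<and> q (j + 1) \<in> carrier_vec d" if "j \<le> m" for j
    using that
  proof (induction j)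
    case 0
    then show ?case using q0 q1 v by simp
  next
    case (Suc j)
    then have IH: "q j \<in> carrier_vec d" "q (Suc j) \<in> carrier_vec d" by auto
    show ?case
    proof (cases "\<beta> (Suc j) = 0")
      case True
      \<comment> \<open>A zero coefficient can occur only at the last step, where the run itself
        prescribes the dimension of the next vector.\<close>
      with nz[of "Suc j"] Suc.prems have "Suc j = m" by fastforce
      with last True IH show ?thesis by auto
    next
      case False
      then show ?thesis using step(3)[of "Suc j"] Suc.prems IH A by (auto simp: r_def)
    qed
  qed
  then show "j \<le> m \<Longrightarrow> q j \<in> carrier_vec d \<and> q (j + 1) \<in> carrier_vec d" .
  show "j \<in> {1..m} \<Longrightarrow> \<alpha> j = q j \<bullet> (A *\<^sub>v q j)" "j \<in> {1..<m} \<Longrightarrow> \<beta> j \<noteq> 0"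
    using step(1) nz by auto
  show "q (j + 1) \<bullet> q (j + 1) = 1" if "j \<in> {1..m}" "\<beta> j \<noteq> 0"
    using step(2,3)[OF that(1)] that(2) scalar_prod_normalized[of "r j"] by metis
  show "A *\<^sub>v q j = \<alpha> j \<cdot>\<^sub>v q j + \<beta> (j - 1) \<cdot>\<^sub>v q (j - 1) + \<beta> j \<cdot>\<^sub>v q (j + 1)"
    if j: "j \<in> {1..m}"
  proof -
    have c: "q j \<in> carrier_vec d" "q (j - 1) \<in> carrier_vec d" "q (j + 1) \<in> carrier_vec d"
      using carr[of j] carr[of "j - 1"] j by auto
    then have rc: "r j \<in> carrier_vec d" using A by (auto simp: r_def)
    have "\<beta> j \<cdot>\<^sub>v q (j + 1) = r j"
    proof (cases "\<beta> j = 0")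
      case True
      then have "r j = 0\<^sub>v d" using step(2)[OF j] vec_norm2_eq_0[OF rc] by simp
      then show ?thesis using True c by (intro eq_vecI) auto
    next
      case False
      then show ?thesis using step(3)[OF j False] by (simp add: smult_smult_assoc)
    qed
    then show ?thesis unfolding r_def using c A by (intro eq_vecI) auto
  qed
qed

text \<open>Induction on the number of vectors. By symmetry of \<open>A\<close>, the product of
  \<open>q i\<close> with \<open>A *\<^sub>v q n\<close> can be expanded by the recurrence at
  \<open>i\<close> instead of \<open>n\<close>, so only earlier vectors occur and the three-term
  subtraction already removes every component.\<close>

lemma lanczos_orthonormal:
  assumes A: "A \<in> carrier_mat d d" and sym: "A\<^sup>T = A"
    and v: "v \<in> carrier_vec d" "v \<noteq> 0\<^sub>v d"
    and run: "lanczos_run A v m \<alpha> \<beta> q"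
    and ij: "i \<in> {1..m}" "j \<in> {1..m}"
  shows "q i \<bullet> q j = (if i = j then 1 else 0)"
proof -
  note L = lanczos_step[OF A v(1) run]
  have b0: "\<beta> 0 = 0" and q1: "q 1 = (1 / vec_norm2 v) \<cdot>\<^sub>v v"
    using run unfolding lanczos_run_def by auto
  have c: "q j \<in> carrier_vec d" if "j \<le> m" for j using L(1)[OF that] by simp
  \<comment> \<open>Gram entries \<open>g\<close> and entries \<open>h\<close> of \<open>A\<close>
    in the Lanczos vectors reduce the argument to scalar recurrences.\<close>
  define g where "g i j = q i \<bullet> q j" for i j
  define h where "h i j = q i \<bullet> (A *\<^sub>v q j)" for i j
  have g_comm: "g i j = g j i" if "i \<le> m" "j \<le> m" for i j
    unfolding g_def using c that comm_scalar_prod by blast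
  have h_comm: "h i j = h j i" if "i \<le> m" "j \<le> m" for i j
    unfolding h_def using c[OF that(1)] c[OF that(2)] A sym
      transpose_vec_mult_scalar[of A d d "q j" "q i"]
    by (metis comm_scalar_prod mult_mat_vec_carrier)
  have h: "h i j = \<alpha> j * g i j + \<beta> (j - 1) * g i (j - 1) + \<beta> j * g i (j + 1)"
    if "i \<le> m" "j \<in> {1..m}" for i j
  proof -
    have "q i \<in> carrier_vec d" "q j \<in> carrier_vec d" "q (j - 1) \<in> carrier_vec d"
      "q (j + 1) \<in> carrier_vec d"
      using c[OF that(1)] c[of j] c[of "j - 1"] L(1)[of j] that(2) by auto
    then show ?thesis
      unfolding h_def g_def L(2)[OF that(2)] by (simp add: scalar_prod_add_distrib[of _ d])
  qed
  have "\<forall>i\<in>{1..n}. \<forall>j\<in>{1..n}. g i j = (if i = j then 1 else 0)" if "n \<le> m" for n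
    using that
  proof (induction n)
    case (Suc n)
    then have IH: "g i j = (if i = j then 1 else 0)" if "i \<in> {1..n}" "j \<in> {1..n}" for i j
      using that by auto
    have norm: "g (Suc n) (Suc n) = 1"
    proof (cases "n = 0")
      case True
      have "vec_norm2 v \<noteq> 0" using vec_norm2_eq_0 v by blast
      then show ?thesis
        using q1 True scalar_prod_normalized[of v] unfolding g_def by (metis One_nat_def)
    next
      case False
      then show ?thesis using L(4)[of n] L(5)[of n] Suc.prems by (simp add: g_def)
    qed
    have orth: "g i (Suc n) = 0" if i: "i \<in> {1..n}" for i
    proof -
      have n: "n \<in> {1..m}" "n \<in> {1..<m}" and im: "i \<in> {1..m}" using i Suc.prems by auto
      have "\<beta> n * g i (Suc n) = h i n - \<alpha> n * g i n - \<beta> (n - 1) * g i (n - 1)"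
        using h[of i n] im n by simp
      also have "\<dots> = 0"
      proof (cases "i = n")
        \<comment> \<open>Here \<open>h n n\<close> is \<open>\<alpha> n\<close> by definition of
          the coefficient. The remaining product vanishes by orthogonality, or by
          \<open>\<beta> 0 = 0\<close> when \<open>n = 1\<close>, as the induction hypothesis does
          not cover index 0.\<close>
        case True
        have "\<beta> (n - 1) * g n (n - 1) = 0"
          using IH[of n "n - 1"] n b0 by (cases "n = 1") auto
        then show ?thesis using L(3)[OF n(1)] IH[of n n] n True by (simp add: h_def)
      next
        case False
        have "g n (i - 1) = 0" if "i \<noteq> 1"
        proof -
          have "i - 1 \<in> {1..n}" "n \<noteq> i - 1" using that i by auto
          then show ?thesis using IH[of n "i - 1"] n by auto
        qed
        then have "\<beta> (i - 1) * g n (i - 1) = 0" using b0 by (cases "i = 1") auto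
        \<comment> \<open>Symmetry lets the recurrence at \<open>i < n\<close> be used: of its three
          terms only the one with \<open>q (i + 1)\<close> can meet \<open>q n\<close>.\<close>
        then have "h i n = \<beta> i * g n (i + 1)"
          using h_comm[of i n] h[of n i] im n i IH[of n i] False by simp
        \<comment> \<open>For \<open>i = n - 1\<close> both sides are \<open>\<beta> i\<close>; for
          smaller \<open>i\<close> both are zero.\<close>
        moreover have "\<beta> (n - 1) * g i (n - 1) = \<beta> i * g n (i + 1)"
        proof (cases "i = n - 1")
          case True
          then show ?thesis using IH[of i i] IH[of n n] i n by auto
        next
          case False
          with \<open>i \<noteq> n\<close> i have "i + 1 \<in> {1..n}" "n - 1 \<in> {1..n}" "i + 1 \<noteq> n" by auto
          then show ?thesis using IH[of i "n - 1"] IH[of n "i + 1"] False i n by auto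
        qed
        ultimately show ?thesis using IH[of i n] False i n by auto
      qed
      \<comment> \<open>Absence of breakdown before step \<open>m\<close> allows cancelling
        \<open>\<beta> n\<close>, since \<open>n < m\<close>.\<close>
      finally show ?thesis using L(5)[OF n(2)] by simp
    qed
    have "g i j = (if i = j then 1 else 0)" if mem: "i \<in> {1..Suc n}" "j \<in> {1..Suc n}" for i j
    proof -
      consider "i = Suc n" "j = Suc n" | "i = Suc n" "j \<in> {1..n}" | "i \<in> {1..n}" "j = Suc n"
        | "i \<in> {1..n}" "j \<in> {1..n}"
        using mem by (auto simp: le_Suc_eq)
      then show ?thesis
        using norm orth IH g_comm[of i j] Suc.prems mem by cases auto
    qed
    then show ?case by blast
  qed simp
  from this[of m] ij show ?thesis by (simp add: g_def)
qed

section \<open>The off-diagonal block of \<open>A\<close>\<close>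

lemma mat_unit_vec_col:
  fixes M :: "real mat"
  assumes "M \<in> carrier_mat d l" "i < l"
  shows "M *\<^sub>v unit_vec l i = col M i"
  using assms by (intro eq_vecI) auto

text \<open>Each column is the image of a unit vector and thus lies in the column space, so the
  inclusion applies to pairs of columns.\<close>

lemma orthogonal_complement_cols:
  fixes Q P :: "real mat"
  assumes Q: "Q \<in> carrier_mat d m" and P: "P \<in> carrier_mat d k"
    and sub: "vec_space.col_space d P
      \<subseteq> vec_module.orthogonal_complement d (vec_space.col_space d Q)"
  shows "Q\<^sup>T * P = 0\<^sub>m m k"
proof (intro eq_matI)
  have col_mem: "col M i \<in> vec_space.col_space d M"
    if "M \<in> carrier_mat d l" "i < l" for M :: "real mat" and i l
    unfolding vec_space.col_space_eq[OF that(1)]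
    using that mat_unit_vec_col[OF that] by (auto intro!: bexI[of _ "unit_vec l i"])
  fix i j assume "i < dim_row (0\<^sub>m m k :: real mat)" "j < dim_col (0\<^sub>m m k :: real mat)"
  then have ij: "i < m" "j < k" by auto
  have "col P j \<bullet> col Q i = 0"
    using col_mem[OF Q ij(1)] col_mem[OF P ij(2)] sub
    unfolding vec_module.orthogonal_complement_def by blast
  then have "col Q i \<bullet> col P j = 0"
    using Q P ij by (metis col_carrier_vec comm_scalar_prod carrier_matD(2))
  then show "(Q\<^sup>T * P) $$ (i, j) = 0\<^sub>m m k $$ (i, j)" using Q P ij by simp
qed (use Q P in auto)

text \<open>By symmetry, entry \<open>(i, j)\<close> pairs \<open>A *\<^sub>v q (i + 1)\<close> with
  column \<open>j\<close> of \<open>P\<close>. The recurrence expresses the former through Lanczos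
  vectors, and among these only \<open>q (m + 1)\<close> is not orthogonal to the range of
  \<open>P\<close>; it appears only in the last row.\<close>

lemma lanczos_cross_block:
  assumes A: "A \<in> carrier_mat d d" and sym: "A\<^sup>T = A" and m: "1 \<le> m"
    and v: "v \<in> carrier_vec d" "v \<noteq> 0\<^sub>v d"
    and run: "lanczos_run A v m \<alpha> \<beta> q"
    and Q: "Q = mat_of_cols d (map q [1..<m+1])"
    and P: "P \<in> carrier_mat d k" "P\<^sup>T * P = 1\<^sub>m k" "Q\<^sup>T * P = 0\<^sub>m m k"
      "col P 0 = q (m + 1)" "0 < k"
  shows "Q\<^sup>T * A * P = \<beta> m \<cdot>\<^sub>m outer_prod (unit_vec m (m - 1)) (unit_vec k 0)"
proof (intro eq_matI)
  note L = lanczos_step[OF A v(1) run]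
  have b0: "\<beta> 0 = 0" using run unfolding lanczos_run_def by auto
  have Qc: "Q \<in> carrier_mat d m" unfolding Q by auto
  \<comment> \<open>Columns are numbered from 0, Lanczos vectors from 1.\<close>
  have colQ: "col Q i = q (i + 1)" if "i < m" for i
    using that L(1)[of i] unfolding Q by (simp del: upt_Suc)
  fix i j assume "i < dim_row (\<beta> m \<cdot>\<^sub>m outer_prod (unit_vec m (m - 1)) (unit_vec k 0))"
    "j < dim_col (\<beta> m \<cdot>\<^sub>m outer_prod (unit_vec m (m - 1)) (unit_vec k 0))"
  then have ij: "i < m" "j < k" by auto
  define p where "p = col P j"
  have p: "p \<in> carrier_vec d" using P(1) unfolding p_def by auto
  have q_p: "q l \<bullet> p = 0" if "l \<in> {1..m}" for l
  proof -
    have "(Q\<^sup>T * P) $$ (l - 1, j) = 0" using P(3) that ij by auto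
    moreover have "l - 1 < m" "l - 1 + 1 = l" using that by auto
    ultimately show ?thesis using colQ[of "l - 1"] P(1) Qc ij unfolding p_def by simp
  qed
  \<comment> \<open>As \<open>q (m + 1)\<close> is the first column of \<open>P\<close>, these
    products form the first row of the identity \<open>P\<^sup>T * P\<close>.\<close>
  have last: "q (m + 1) \<bullet> p = unit_vec k 0 $ j"
  proof -
    have "(P\<^sup>T * P) $$ (0, j) = (if j = 0 then 1 else 0)" using P(2,5) ij by auto
    then show ?thesis using P(1,4,5) ij unfolding p_def by auto
  qed
  have c: "q i \<in> carrier_vec d" "q (i + 1) \<in> carrier_vec d" "q (i + 2) \<in> carrier_vec d"
    using L(1)[of i] L(1)[of "i + 1"] ij by auto
  have "(Q\<^sup>T * A * P) $$ (i, j) = row (Q\<^sup>T * (A * P)) i $ j"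
    using Qc A P ij by (simp add: mult_mat_assoc)
  also have "\<dots> = q (i + 1) \<bullet> (A *\<^sub>v p)"
    using Qc A P ij colQ[of i] by (simp add: p_def mult_mat_vec_def)
  also have "\<dots> = (A *\<^sub>v q (i + 1)) \<bullet> p"
    using transpose_vec_mult_scalar[of A d d p "q (i + 1)"] A sym p c
    by simp
  also have "\<dots> = \<alpha> (i + 1) * (q (i + 1) \<bullet> p) + \<beta> i * (q i \<bullet> p) + \<beta> (i + 1) * (q (i + 2) \<bullet> p)"
    using L(2)[of "i + 1"] ij c p by (simp add: add_scalar_prod_distrib[of _ d])
  \<comment> \<open>In the first row the term with \<open>q 0\<close> is removed by
    \<open>\<beta> 0 = 0\<close>, in later rows by orthogonality.\<close>
  also have "\<dots> = \<beta> (i + 1) * (q (i + 2) \<bullet> p)"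
    using q_p[of "i + 1"] q_p[of i] ij b0 by (cases "i = 0") auto
  also have "\<dots> = \<beta> m * (unit_vec m (m - 1) $ i * unit_vec k 0 $ j)"
  proof (cases "i + 1 = m")
    case True
    then show ?thesis using last ij by (auto simp: numeral_2_eq_2)
  next
    case False
    then show ?thesis using q_p[of "i + 2"] ij by auto
  qed
  finally show "(Q\<^sup>T * A * P) $$ (i, j)
      = (\<beta> m \<cdot>\<^sub>m outer_prod (unit_vec m (m - 1)) (unit_vec k 0)) $$ (i, j)"
    using ij by simp
qed (use P in \<open>auto simp: Q\<close>)

section \<open>Assembly of the inverse from its blocks\<close>

theorem proposition3:
  fixes d m :: nat
    and A Q Qp T Tp Ax S :: "real mat"
    and v q_par q_perp :: "real vec"
    and \<alpha> \<beta> :: "nat \<Rightarrow> real"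
    and q :: "nat \<Rightarrow> real vec"
    and \<gamma> :: real
  assumes A: "sym_pos_def d A"
    and m: "1 \<le> m" "m < d"
    and v: "v \<in> carrier_vec d" "v \<noteq> 0\<^sub>v d"
    and lanczos: "lanczos_run A v m \<alpha> \<beta> q"
    and Q: "Q = mat_of_cols d (map q [1..<m+1])"
    and T: "T = Q\<^sup>T * A * Q"
    and Qp: "Qp \<in> carrier_mat d (d - m)" "orthonormal_cols Qp"
      "vec_space.col_space d Qp
         = vec_module.orthogonal_complement d (vec_space.col_space d Q)"
      "col Qp 0 = q (m + 1)"
    and Tp: "Tp = Qp\<^sup>T * A * Qp"
    and Ax: "Ax = Q\<^sup>T * A * Qp"
    and \<gamma>: "\<gamma> = (\<beta> m)\<^sup>2 * minv T $$ (m - 1, m - 1)"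
    and S: "S = Tp - \<gamma> \<cdot>\<^sub>m outer_prod (unit_vec (d - m) 0) (unit_vec (d - m) 0)"
    and q_par: "q_par = \<beta> m \<cdot>\<^sub>v (Q *\<^sub>v (minv T *\<^sub>v unit_vec m (m - 1)))"
    and q_perp: "q_perp = Qp *\<^sub>v (minv S *\<^sub>v unit_vec (d - m) 0)"
  shows "
    invertible_mat T \<and> invertible_mat S \<and>
    Ax = \<beta> m \<cdot>\<^sub>m outer_prod (unit_vec m (m - 1)) (unit_vec (d - m) 0) \<and>
    S = Tp - Ax\<^sup>T * minv T * Ax \<and>
    Qp\<^sup>T * minv A * Qp = minv S \<and>
    Q\<^sup>T * minv A * Q = minv T + ((\<beta> m)\<^sup>2 * minv S $$ (0, 0)) \<cdot>\<^sub>m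
      outer_prod (minv T *\<^sub>v unit_vec m (m - 1)) (minv T *\<^sub>v unit_vec m (m - 1)) \<and>
    Q\<^sup>T * minv A * Qp = - (minv T * Ax * minv S) \<and>
    Q\<^sup>T * minv A * Qp = - (\<beta> m) \<cdot>\<^sub>m
      outer_prod (minv T *\<^sub>v unit_vec m (m - 1)) (minv S *\<^sub>v unit_vec (d - m) 0) \<and>
    minv A = Q * minv T * Q\<^sup>T + (minv S $$ (0, 0)) \<cdot>\<^sub>m outer_prod q_par q_par
      - outer_prod q_par q_perp - outer_prod q_perp q_par + Qp * minv S * Qp\<^sup>T \<and>
    (\<beta> m = 0 \<longrightarrow>
      \<gamma> = 0 \<and> S = Tp \<and>
      outer_prod q_par q_par = 0\<^sub>m d d \<and>
      outer_prod q_par q_perp = 0\<^sub>m d d \<and>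
      outer_prod q_perp q_par = 0\<^sub>m d d \<and>
      minv A = Q * minv T * Q\<^sup>T + Qp * minv Tp * Qp\<^sup>T)"
proof -
  define k where "k = d - m"
  have k: "0 < k" "d = m + k" using m by (auto simp: k_def)
  define em e1 where "em = (unit_vec m (m - 1) :: real vec)" and "e1 = (unit_vec k 0 :: real vec)"
  define W Z t z where "W = minv T" and "Z = minv S" and "t = W *\<^sub>v em" and "z = Z *\<^sub>v e1"
  have Ac: "A \<in> carrier_mat d d" and sym: "A\<^sup>T = A" using A unfolding sym_pos_def_def by auto
  have Qc: "Q \<in> carrier_mat d m" unfolding Q by auto
  have colQ: "col Q i = q (i + 1)" if "i < m" for i
    using that lanczos_step(1)[OF Ac v(1) lanczos, of i] unfolding Q by (simp del: upt_Suc)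
  have QQ: "Q\<^sup>T * Q = 1\<^sub>m m"
    using Qc colQ lanczos_orthonormal[OF Ac sym v lanczos] by (intro eq_matI) auto
  have P: "Qp \<in> carrier_mat d k" and PP: "Qp\<^sup>T * Qp = 1\<^sub>m k"
    using Qp(1,2) unfolding orthonormal_cols_def k_def by auto
  have QP: "Q\<^sup>T * Qp = 0\<^sub>m m k"
    using orthogonal_complement_cols[OF Qc P] Qp(3) by simp
  have full: "Q * Q\<^sup>T + Qp * Qp\<^sup>T = 1\<^sub>m d"
    using orthonormal_cols_completion[of Q m k Qp] Qc P QQ PP QP k by simp
  have Ax_eq: "Ax = \<beta> m \<cdot>\<^sub>m outer_prod em e1"
    unfolding Ax em_def e1_def
    by (rule lanczos_cross_block[OF Ac sym m(1) v lanczos Q P PP QP Qp(4) k(1)])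
  note W = sym_pos_def_minv[OF sym_pos_def_compress[OF A Qc QQ, folded T], folded W_def]
  have dim_e [simp]: "dim_vec em = m" "dim_vec e1 = k"
    "em \<in> carrier_vec m" "e1 \<in> carrier_vec k" by (auto simp: em_def e1_def)
  have t: "t \<in> carrier_vec m" using W(1) by (auto simp: t_def)
  have emt: "em \<bullet> t = W $$ (m - 1, m - 1)"
    unfolding em_def t_def by (rule unit_vec_quadratic_form) (use W m in auto)
  have WAx: "W * Ax = \<beta> m \<cdot>\<^sub>m outer_prod t e1"
    unfolding Ax_eq t_def using W(1) by (simp add: mult_mat_smult_right mult_outer_prod)
  have AxT: "Ax\<^sup>T = \<beta> m \<cdot>\<^sub>m outer_prod e1 em"
    unfolding Ax_eq transpose_outer_prod[of em, symmetric] by (intro eq_matI) auto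
  have AxTW: "Ax\<^sup>T * W = \<beta> m \<cdot>\<^sub>m outer_prod e1 t"
    unfolding AxT t_def using W(1,4) by (simp add: mult_mat_smult_left outer_prod_mult)
  \<comment> \<open>Both outer factors have rank one, so the middle collapses to the scalar
    \<open>em \<bullet> t\<close>, the last diagonal entry of \<open>W\<close>. Hence the given
    \<open>S\<close> is the Schur complement and \<open>block_inverse\<close> applies.\<close>
  have "Ax\<^sup>T * W * Ax = \<gamma> \<cdot>\<^sub>m outer_prod e1 e1"
  proof -
    have "Ax\<^sup>T * W * Ax = Ax\<^sup>T * (W * Ax)"
      using W(1) by (intro mult_mat_assoc) (auto simp: Ax_eq)
    also have "\<dots> = (\<beta> m * (\<beta> m * (em \<bullet> t))) \<cdot>\<^sub>m outer_prod e1 e1"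
      unfolding WAx AxT using t
      by (simp add: mult_mat_smult_left mult_mat_smult_right outer_prod_mult_outer_prod
          smult_smult_mat mult.assoc)
    finally show ?thesis by (simp add: emt \<gamma> W_def power2_eq_square mult.assoc)
  qed
  then have S_eq: "S = Tp - Ax\<^sup>T * minv T * Ax"
    unfolding S by (simp add: W_def e1_def k_def)
  note blocks = block_inverse[OF A Qc P QQ PP QP full T Tp Ax S_eq, folded Z_def W_def]
  have Zc: "Z \<in> carrier_mat k k" and ZT: "Z\<^sup>T = Z" using blocks by auto
  have z: "z \<in> carrier_vec k" using Zc by (auto simp: z_def)
  have "e1 \<bullet> z = Z $$ (0, 0)"
    unfolding e1_def z_def by (rule unit_vec_quadratic_form) (use Zc k in auto)
  then have ze1: "z \<bullet> e1 = Z $$ (0, 0)"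
    using comm_scalar_prod[OF z dim_e(4)] by simp
  \<comment> \<open>Symmetry of \<open>Z\<close> turns its action from the right on
    \<open>e1\<close> into the vector \<open>z\<close>.\<close>
  have WAxZ: "W * Ax * Z = \<beta> m \<cdot>\<^sub>m outer_prod t z"
    unfolding WAx z_def using Zc ZT by (simp add: mult_mat_smult_left outer_prod_mult)
  have Y: "Q\<^sup>T * minv A * Qp = - (\<beta> m) \<cdot>\<^sub>m outer_prod t z"
    unfolding blocks(5) WAxZ by (intro eq_matI) auto
  have X: "Q\<^sup>T * minv A * Q = W + ((\<beta> m)\<^sup>2 * Z $$ (0, 0)) \<cdot>\<^sub>m outer_prod t t"
  proof -
    have "W * Ax * Z * Ax\<^sup>T * W = W * Ax * Z * (Ax\<^sup>T * W)"
      using W(1) Zc by (intro mult_mat_assoc) (auto simp: Ax_eq)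
    \<comment> \<open>The inner pair of vectors contracts to the corner entry of
      \<open>Z\<close>.\<close>
    also have "\<dots> = (\<beta> m * (\<beta> m * (z \<bullet> e1))) \<cdot>\<^sub>m outer_prod t t"
      unfolding WAxZ AxTW using z t
      by (simp add: mult_mat_smult_left mult_mat_smult_right outer_prod_mult_outer_prod
          smult_smult_mat mult.assoc)
    finally show ?thesis unfolding blocks(6) by (simp add: ze1 power2_eq_square mult.assoc)
  qed
  have par: "q_par = \<beta> m \<cdot>\<^sub>v (Q *\<^sub>v t)" and perp: "q_perp = Qp *\<^sub>v z"
    unfolding q_par q_perp by (simp_all add: t_def z_def W_def Z_def em_def e1_def k_def)
  have dim_q [simp]: "dim_vec q_par = d" "dim_vec q_perp = d"
    unfolding par perp using Qc P by auto
  have QXQ: "Q * (Q\<^sup>T * minv A * Q) * Q\<^sup>T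
      = Q * W * Q\<^sup>T + (Z $$ (0, 0)) \<cdot>\<^sub>m outer_prod q_par q_par"
    unfolding X par using Qc W(1) t
    by (simp add: mult_mat_add_left mult_mat_add_right mult_mat_smult_left mult_mat_smult_right
        mult_outer_prod outer_prod_mult outer_prod_smult smult_smult_mat power2_eq_square
        mult.assoc mult.commute mult.left_commute)
  \<comment> \<open>The factor \<open>\<beta> m\<close> is absorbed into \<open>q_par\<close>; the
    sign stays a scalar factor so that the scaling rules apply.\<close>
  have QYP: "Q * (Q\<^sup>T * minv A * Qp) * Qp\<^sup>T = (- 1) \<cdot>\<^sub>m outer_prod q_par q_perp"
    unfolding Y par perp using Qc P t z
    by (simp add: mult_mat_smult_left mult_mat_smult_right
        mult_outer_prod outer_prod_mult outer_prod_smult smult_smult_mat)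
  have PYQ: "Qp * (Q\<^sup>T * minv A * Qp)\<^sup>T * Q\<^sup>T = (- 1) \<cdot>\<^sub>m outer_prod q_perp q_par"
  proof -
    have "(Q\<^sup>T * minv A * Qp)\<^sup>T = - (\<beta> m) \<cdot>\<^sub>m outer_prod z t"
      unfolding Y transpose_outer_prod[of t, symmetric] by (intro eq_matI) auto
    then show ?thesis
      unfolding par perp using Qc P t z
      by (simp add: mult_mat_smult_left mult_mat_smult_right
          mult_outer_prod outer_prod_mult outer_prod_smult smult_smult_mat)
  qed
  have inv: "minv A = Q * W * Q\<^sup>T + (Z $$ (0, 0)) \<cdot>\<^sub>m outer_prod q_par q_par
      - outer_prod q_par q_perp - outer_prod q_perp q_par + Qp * Z * Qp\<^sup>T"
    using blocks(7) unfolding QXQ QYP PYQ blocks(4)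
    using Qc P W(1) Zc by (intro eq_matI) auto
  \<comment> \<open>With \<open>\<beta> m = 0\<close> the vector \<open>q_par\<close> vanishes, and
    \<open>S\<close> becomes \<open>Tp\<close>, so \<open>Z\<close> is the inverse of
    \<open>Tp\<close>.\<close>
  have deflated: "\<gamma> = 0 \<and> S = Tp \<and> outer_prod q_par q_par = 0\<^sub>m d d \<and>
      outer_prod q_par q_perp = 0\<^sub>m d d \<and> outer_prod q_perp q_par = 0\<^sub>m d d \<and>
      minv A = Q * minv T * Q\<^sup>T + Qp * minv Tp * Qp\<^sup>T" if b: "\<beta> m = 0"
  proof -
    have g: "\<gamma> = 0" using \<gamma> b by simp
    have STp: "S = Tp"
      unfolding S g using Ac P by (intro eq_matI) (auto simp: Tp k_def)
    have par0: "q_par = 0\<^sub>v d" unfolding par b using Qc by (intro eq_vecI) auto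
    have outer0: "outer_prod q_par q_par = 0\<^sub>m d d" "outer_prod q_par q_perp = 0\<^sub>m d d"
      "outer_prod q_perp q_par = 0\<^sub>m d d"
      unfolding par0 by (intro eq_matI; auto)+
    have "minv A = Q * W * Q\<^sup>T + Qp * Z * Qp\<^sup>T"
      unfolding inv outer0 using Qc P W(1) Zc by (intro eq_matI) auto
    then show ?thesis using g STp outer0 by (simp add: W_def Z_def)
  qed
  show ?thesis
    using W(5) blocks(1,4,5) Ax_eq S_eq X Y inv deflated
    unfolding t_def z_def W_def Z_def em_def e1_def k_def by blast
qed

end
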